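(* Let $\Pi_2\subseteq\mathbb{R}^d$ be a bounded domain (nonempty, open, connected), let $\sigma:\mathbb{R}\to\mathbb{R}^+$ be a one-to-one $C^\infty$ function, and let $c\ge 0$. Let $\mathcal{P}_s(\Pi_2)$ be the set of finite signed measures compactly supported on $\Pi_2$, identified with their densities $f$ (functions on $\Pi_2$, up to a.e. equality), for which the normalization $$P_\sigma(f)(t)=\frac{\sigma(f(t))+c}{\int_{\Pi_2}\bigl(\sigma(f(\tau))+c\bigr)\,d\tau},\qquad t\in\Pi_2,$$ is well defined (i.e. the integral in the denominator is finite). Define $W_\sigma(f,g)=W_2(P_\sigma(f),P_\sigma(g))$ for $f,g\in\mathcal{P}_s(\Pi_2)$. Then $W_\sigma$ defines a metric on $\mathcal{P}_s(\Pi_2)$.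
   Context: $\mathbb{R}^+$ denotes the positive reals. "Compactly supported on $\Pi_2$" means that the support is a compact subset of $\Pi_2$. $P_\sigma(f)$ is a probability density on $\Pi_2$. $W_2$ is the quadratic Wasserstein distance between probability measures (identified with their densities): $W_2^2(\mu,\nu)=\inf_\pi\int|x-y|^2\,d\pi(x,y)$ over couplings $\pi$ of $\mu$ and $\nu$. *)

theory Defs
  imports "HOL-Analysis.Analysis"
begin

text \<open>A real function is \<open>C\<^sup>\<infinity>\<close> iff all its iterated derivatives are differentiable everywhere
  (continuity of the derivatives is then automatic).\<close>

definition C_infinity :: "(real \<Rightarrow> real) \<Rightarrow> bool" where
  "C_infinity h \<longleftrightarrow> (\<forall>n. (deriv ^^ n) h differentiable_on UNIV)"

definition couplings :: "'a::euclidean_space measure \<Rightarrow> 'a measure \<Rightarrow> ('a \<times> 'a) measure set" where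
  "couplings \<mu> \<nu> =
     {\<pi>. sets \<pi> = sets (borel \<Otimes>\<^sub>M borel) \<and> distr \<pi> borel fst = \<mu> \<and> distr \<pi> borel snd = \<nu>}"

definition W2_sq :: "'a::euclidean_space measure \<Rightarrow> 'a measure \<Rightarrow> ennreal" where
  "W2_sq \<mu> \<nu> = (INF \<pi>\<in>couplings \<mu> \<nu>. \<integral>\<^sup>+ (x, y). ennreal ((norm (x - y))\<^sup>2) \<partial>\<pi>)"

text \<open>An infinite transport cost would be mapped to \<open>0\<close> here, so finiteness of \<^const>\<open>W2_sq\<close> has to be
  stated separately where it matters.\<close>

definition W2 :: "'a::euclidean_space measure \<Rightarrow> 'a measure \<Rightarrow> real" where
  "W2 \<mu> \<nu> = sqrt (enn2real (W2_sq \<mu> \<nu>))"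

text \<open>Functions on \<open>\<Omega>\<close> are represented by total functions whose values outside \<open>\<Omega>\<close> are irrelevant.
  The support is that of the signed measure with density \<open>f\<close> on \<open>\<Omega>\<close>, i.e. the essential support of
  \<open>f\<close>; unlike the closure of the set where \<open>f\<close> is nonzero, it only depends on the a.e.-class
  of \<open>f\<close>.\<close>

definition density_support :: "'a::euclidean_space set \<Rightarrow> ('a \<Rightarrow> real) \<Rightarrow> 'a set" where
  "density_support \<Omega> f =
     {x \<in> \<Omega>. \<forall>U. open U \<longrightarrow> x \<in> U \<longrightarrow> \<not> (AE y\<in>\<Omega> \<inter> U in lborel. f y = 0)}"

text \<open>Densities of the members of \<open>\<P>\<^sub>s(\<Omega>)\<close>: integrability of \<open>f\<close> says that the signed measure
  is finite, the last condition that the normalising integral is finite.\<close>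

definition signed_densities ::
    "'a::euclidean_space set \<Rightarrow> (real \<Rightarrow> real) \<Rightarrow> real \<Rightarrow> ('a \<Rightarrow> real) set" where
  "signed_densities \<Omega> \<sigma> c =
     {f. set_integrable lborel \<Omega> f \<and> compact (density_support \<Omega> f) \<and>
         set_integrable lborel \<Omega> (\<lambda>t. \<sigma> (f t) + c)}"

definition ae_rel ::
    "'a::euclidean_space set \<Rightarrow> (real \<Rightarrow> real) \<Rightarrow> real \<Rightarrow> (('a \<Rightarrow> real) \<times> ('a \<Rightarrow> real)) set" where
  "ae_rel \<Omega> \<sigma> c =
     {(f, g). f \<in> signed_densities \<Omega> \<sigma> c \<and> g \<in> signed_densities \<Omega> \<sigma> c \<and>
              (AE t\<in>\<Omega> in lborel. f t = g t)}"

definition P_s ::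
    "'a::euclidean_space set \<Rightarrow> (real \<Rightarrow> real) \<Rightarrow> real \<Rightarrow> ('a \<Rightarrow> real) set set" where
  "P_s \<Omega> \<sigma> c = signed_densities \<Omega> \<sigma> c // ae_rel \<Omega> \<sigma> c"

definition P_sigma ::
    "'a::euclidean_space set \<Rightarrow> (real \<Rightarrow> real) \<Rightarrow> real \<Rightarrow> ('a \<Rightarrow> real) \<Rightarrow> 'a \<Rightarrow> real" where
  "P_sigma \<Omega> \<sigma> c f t = (\<sigma> (f t) + c) / (LINT \<tau>:\<Omega>|lborel. \<sigma> (f \<tau>) + c)"

definition P_sigma_measure ::
    "'a::euclidean_space set \<Rightarrow> (real \<Rightarrow> real) \<Rightarrow> real \<Rightarrow> ('a \<Rightarrow> real) \<Rightarrow> 'a measure" where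
  "P_sigma_measure \<Omega> \<sigma> c f = density lborel (\<lambda>t. ennreal (P_sigma \<Omega> \<sigma> c f t) * indicator \<Omega> t)"

definition W_sigma ::
    "'a::euclidean_space set \<Rightarrow> (real \<Rightarrow> real) \<Rightarrow> real \<Rightarrow> ('a \<Rightarrow> real) \<Rightarrow> ('a \<Rightarrow> real) \<Rightarrow> real" where
  "W_sigma \<Omega> \<sigma> c f g = W2 (P_sigma_measure \<Omega> \<sigma> c f) (P_sigma_measure \<Omega> \<sigma> c g)"

text \<open>The induced function on a.e.-classes, evaluated on arbitrary representatives. Independence of
  the representatives is \<open>W_sigma \<Omega> \<sigma> c respects2 ae_rel \<Omega> \<sigma> c\<close>.\<close>

definition W_sigma_class ::
    "'a::euclidean_space set \<Rightarrow> (real \<Rightarrow> real) \<Rightarrow> real \<Rightarrow> ('a \<Rightarrow> real) set \<Rightarrow> ('a \<Rightarrow> real) set \<Rightarrow> real" where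
  "W_sigma_class \<Omega> \<sigma> c F G = W_sigma \<Omega> \<sigma> c (SOME f. f \<in> F) (SOME g. g \<in> G)"

end

theory Submission
  imports Defs "HOL-Probability.Giry_Monad"
begin

text \<open>The triangle inequality for \<^const>\<open>W2\<close> is usually obtained by gluing two couplings along their
  common marginal, which needs disintegration. Since \<^const>\<open>W2_sq\<close> is an infimum it is enough to glue
  approximately: for a countable partition of the space into cells of diameter at most \<open>e\<close>, couple
  the two middle points only to lie in the same cell. Such a gluing has an explicit density
  with respect to the product of the two couplings, and costs an additional \<open>e\<close>.

  Definiteness does not need optimal couplings either: couplings of arbitrarily small cost give
  \<open>\<mu> A \<le> \<nu> (N A)\<close> for every closed \<open>A\<close> and every neighbourhood \<open>N A\<close>. Hence
  \<open>P_sigma f = P_sigma g\<close> almost everywhere when the distance of \<open>f\<close> and \<open>g\<close> is \<open>0\<close>. The supports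
  being compact, \<open>f\<close> and \<open>g\<close> vanish together on a nonempty open set, so the normalizing constants
  agree, and injectivity of \<open>\<sigma>\<close> gives \<open>f = g\<close>.\<close>

section \<open>Approximate gluing\<close>

text \<open>Reweight the product measure: on each pair of matching cells use the inverse of the
  cell's mass, elsewhere 0. By \<open>law\<close> both factors give a cell the same mass, so
  integrating out either coordinate leaves 1 off the null cells, and both marginals survive.\<close>

lemma glue_along_discrete_maps:
  fixes q :: "'a \<Rightarrow> nat" and r :: "'b \<Rightarrow> nat"
  assumes P: "prob_space P" and Q: "prob_space Q"
    and [measurable]: "q \<in> measurable P (count_space UNIV)" "r \<in> measurable Q (count_space UNIV)"
    and law: "distr P (count_space UNIV) q = distr Q (count_space UNIV) r"
  obtains \<gamma> where "sets \<gamma> = sets (P \<Otimes>\<^sub>M Q)" "distr \<gamma> P fst = P" "distr \<gamma> Q snd = Q"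
    "AE w in \<gamma>. q (fst w) = r (snd w)"
proof -
  interpret P: prob_space P by fact
  interpret Q: prob_space Q by fact
  interpret PQ: pair_prob_space P Q ..
  define D where "D = distr P (count_space UNIV) q"
  have D': "D = distr Q (count_space UNIV) r"
    using law by (simp add: D_def)
  interpret D: prob_space D
    unfolding D_def by (rule P.prob_space_distr) simp
  have setsD [simp]: "sets D = UNIV" "space D = UNIV"
    by (simp_all add: D_def)
  \<comment> \<open>Countability of the values enters here: the null cells, on which the inverse
    mass is infinite, form a null set together.\<close>
  have "(\<Union>n\<in>{n. emeasure D {n} = 0}. {n}) \<in> null_sets D"
    by (intro null_sets_UN') auto
  then have "AE n in D. emeasure D {n} \<noteq> 0"
    by (rule AE_I') auto
  then have AEq: "AE x in P. emeasure D {q x} \<noteq> 0" and AEr: "AE y in Q. emeasure D {r y} \<noteq> 0"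
    using AE_distrD[of q P "count_space UNIV" "\<lambda>n. emeasure D {n} \<noteq> 0", folded D_def]
      AE_distrD[of r Q "count_space UNIV" "\<lambda>n. emeasure D {n} \<noteq> 0", folded D']
    by simp_all
  have Dq: "emeasure D {n} = emeasure P {x\<in>space P. n = q x}" for n
    unfolding D_def by (subst emeasure_distr) (auto intro!: arg_cong[where f="emeasure P"])
  have Dr: "emeasure D {n} = emeasure Q {y\<in>space Q. n = r y}" for n
    unfolding D' by (subst emeasure_distr) (auto intro!: arg_cong[where f="emeasure Q"])
  \<comment> \<open>Given \<open>x\<close>, the point \<open>y\<close> is drawn from \<open>Q\<close> conditioned on the event \<open>r y = q x\<close>.\<close>
  define h where "h = (\<lambda>(x, y). if q x = r y then inverse (emeasure D {q x}) else 0)"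
  have "(\<lambda>w. (q (fst w), r (snd w))) \<in> measurable (P \<Otimes>\<^sub>M Q) (count_space UNIV)"
    by measurable
  then have "(\<lambda>w. (q (fst w), r (snd w))) -` {(i, j). i = j} \<inter> space (P \<Otimes>\<^sub>M Q) \<in> sets (P \<Otimes>\<^sub>M Q)"
    by (rule measurable_sets) simp
  also have "(\<lambda>w. (q (fst w), r (snd w))) -` {(i, j). i = j} \<inter> space (P \<Otimes>\<^sub>M Q)
      = {w \<in> space (P \<Otimes>\<^sub>M Q). q (fst w) = r (snd w)}"
    by auto
  finally have eq_sets: "{w \<in> space (P \<Otimes>\<^sub>M Q). q (fst w) = r (snd w)} \<in> sets (P \<Otimes>\<^sub>M Q)" .
  have "(\<lambda>w. q (fst w)) \<in> measurable (P \<Otimes>\<^sub>M Q) (count_space UNIV)"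
    by measurable
  then have "(\<lambda>w. inverse (emeasure D {q (fst w)})) \<in> borel_measurable (P \<Otimes>\<^sub>M Q)"
    by (rule measurable_compose) simp
  then have "(\<lambda>w. if q (fst w) = r (snd w) then inverse (emeasure D {q (fst w)}) else 0) \<in> borel_measurable (P \<Otimes>\<^sub>M Q)"
    using eq_sets by (rule measurable_If[OF _ borel_measurable_const])
  then have [measurable]: "h \<in> borel_measurable (P \<Otimes>\<^sub>M Q)"
    by (simp add: h_def case_prod_beta')
  \<comment> \<open>Cancellation in \<open>ennreal\<close> needs a factor that is neither 0 nor
    infinite.\<close>
  have canc: "inverse (emeasure D {n}) * emeasure D {n} = 1" if "emeasure D {n} \<noteq> 0" for n
  proof -
    have "emeasure D {n} < top"
      by (simp add: less_top[symmetric])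
    then show ?thesis
      using ennreal_divide_self[OF that] by (simp add: divide_ennreal_def mult.commute)
  qed
  have h1: "(\<integral>\<^sup>+ y. h (x, y) \<partial>Q) = 1" if "emeasure D {q x} \<noteq> 0" for x
  proof -
    have "(\<integral>\<^sup>+ y. h (x, y) \<partial>Q) = (\<integral>\<^sup>+ y. inverse (emeasure D {q x}) * indicator {y\<in>space Q. q x = r y} y \<partial>Q)"
      by (intro nn_integral_cong) (auto simp: h_def)
    also have "\<dots> = inverse (emeasure D {q x}) * emeasure D {q x}"
      by (subst nn_integral_cmult_indicator) (auto simp: Dr)
    finally show ?thesis using canc[OF that] by simp
  qed
  have h2: "(\<integral>\<^sup>+ x. h (x, y) \<partial>P) = 1" if "emeasure D {r y} \<noteq> 0" for y
  proof -
    have "(\<integral>\<^sup>+ x. h (x, y) \<partial>P) = (\<integral>\<^sup>+ x. inverse (emeasure D {r y}) * indicator {x\<in>space P. r y = q x} x \<partial>P)"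
      by (intro nn_integral_cong) (auto simp: h_def)
    also have "\<dots> = inverse (emeasure D {r y}) * emeasure D {r y}"
      by (subst nn_integral_cmult_indicator) (auto simp: Dq)
    finally show ?thesis using canc[OF that] by simp
  qed
  define \<gamma> where "\<gamma> = density (P \<Otimes>\<^sub>M Q) h"
  have [measurable_cong]: "sets \<gamma> = sets (P \<Otimes>\<^sub>M Q)"
    by (simp add: \<gamma>_def)
  have "distr \<gamma> P fst = P"
  proof (rule measure_eqI)
    fix A assume "A \<in> sets (distr \<gamma> P fst)"
    then have [measurable]: "A \<in> sets P" by simp
    have "emeasure (distr \<gamma> P fst) A = (\<integral>\<^sup>+ w. indicator A (fst w) \<partial>\<gamma>)"
      by (subst nn_integral_indicator[symmetric], simp, subst nn_integral_distr) auto
    also have "\<dots> = (\<integral>\<^sup>+ w. h w * indicator A (fst w) \<partial>(P \<Otimes>\<^sub>M Q))"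
      unfolding \<gamma>_def by (subst nn_integral_density) auto
    also have "\<dots> = (\<integral>\<^sup>+ x. (\<integral>\<^sup>+ y. h (x, y) * indicator A x \<partial>Q) \<partial>P)"
      by (subst Q.nn_integral_fst[symmetric]) auto
    also have "\<dots> = (\<integral>\<^sup>+ x. (\<integral>\<^sup>+ y. h (x, y) \<partial>Q) * indicator A x \<partial>P)"
      by (intro nn_integral_cong nn_integral_multc) auto
    also have "\<dots> = (\<integral>\<^sup>+ x. indicator A x \<partial>P)"
      using AEq by (intro nn_integral_cong_AE) (auto simp: h1)
    finally show "emeasure (distr \<gamma> P fst) A = emeasure P A" by simp
  qed simp
  moreover have "distr \<gamma> Q snd = Q"
  proof (rule measure_eqI)
    fix A assume "A \<in> sets (distr \<gamma> Q snd)"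
    then have [measurable]: "A \<in> sets Q" by simp
    have "emeasure (distr \<gamma> Q snd) A = (\<integral>\<^sup>+ w. indicator A (snd w) \<partial>\<gamma>)"
      by (subst nn_integral_indicator[symmetric], simp, subst nn_integral_distr) auto
    also have "\<dots> = (\<integral>\<^sup>+ w. h w * indicator A (snd w) \<partial>(P \<Otimes>\<^sub>M Q))"
      unfolding \<gamma>_def by (subst nn_integral_density) auto
    also have "\<dots> = (\<integral>\<^sup>+ y. (\<integral>\<^sup>+ x. h (x, y) * indicator A y \<partial>P) \<partial>Q)"
      by (subst PQ.nn_integral_snd[symmetric]) auto
    also have "\<dots> = (\<integral>\<^sup>+ y. (\<integral>\<^sup>+ x. h (x, y) \<partial>P) * indicator A y \<partial>Q)"
      by (intro nn_integral_cong nn_integral_multc) auto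
    also have "\<dots> = (\<integral>\<^sup>+ y. indicator A y \<partial>Q)"
      using AEr by (intro nn_integral_cong_AE) (auto simp: h2)
    finally show "emeasure (distr \<gamma> Q snd) A = emeasure Q A" by simp
  qed simp
  moreover have "AE w in \<gamma>. q (fst w) = r (snd w)"
    unfolding \<gamma>_def by (subst AE_density, simp) (auto simp: h_def split: if_splits)
  ultimately show ?thesis
    by (intro that[of \<gamma>]) (auto simp: \<gamma>_def)
qed

text \<open>Enumerate a countable dense set and send each point to the first member within
  \<open>e / 2\<close>. Points of one cell share this center, hence are at most \<open>e\<close>
  apart.\<close>

lemma countable_partition_small_diameter:
  fixes e :: real
  assumes "e > 0"
  obtains q :: "'a::euclidean_space \<Rightarrow> nat"
  where "q \<in> measurable borel (count_space UNIV)" "\<And>x y. q x = q y \<Longrightarrow> norm (x - y) \<le> e"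
proof -
  obtain D :: "'a set" where D: "countable D" "\<And>X. open X \<Longrightarrow> X \<noteq> {} \<Longrightarrow> \<exists>d\<in>D. d \<in> X"
    using countable_dense_setE by blast
  have "D \<noteq> {}"
    using D(2)[of UNIV] by auto
  define d where "d = from_nat_into D"
  have ex: "\<exists>n. dist x (d n) < e / 2" for x
  proof -
    obtain y where "y \<in> D" "y \<in> ball x (e / 2)"
      using D(2)[of "ball x (e / 2)"] assms by auto
    then show ?thesis
      using from_nat_into_surj[OF D(1)] unfolding d_def by (metis mem_ball)
  qed
  define q where "q x = (LEAST n. dist x (d n) < e / 2)" for x
  have near: "dist x (d (q x)) < e / 2" for x
    unfolding q_def by (rule LeastI_ex[OF ex])
  show ?thesis
  proof
    show "q \<in> measurable borel (count_space UNIV)"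
      unfolding q_def by measurable
    show "norm (x - y) \<le> e" if "q x = q y" for x y
      using near[of x] near[of y] that dist_triangle2[of x y "d (q x)"] by (simp add: dist_norm)
  qed
qed

section \<open>The Wasserstein distance\<close>

lemma prob_space_coupling:
  assumes "\<pi> \<in> couplings \<mu> \<nu>" "prob_space \<mu>"
  shows "prob_space \<pi>"
proof -
  have [measurable_cong]: "sets \<pi> = sets (borel \<Otimes>\<^sub>M borel)" and d: "distr \<pi> borel fst = \<mu>"
    using assms by (auto simp: couplings_def)
  have "fst \<in> measurable \<pi> borel"
    by measurable
  then show ?thesis
    by (rule prob_space_distrD) (simp add: d assms(2))
qed

lemma W2_sq_le:
  "\<pi> \<in> couplings \<mu> \<nu> \<Longrightarrow> W2_sq \<mu> \<nu> \<le> (\<integral>\<^sup>+ (x, y). ennreal ((norm (x - y))\<^sup>2) \<partial>\<pi>)"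
  unfolding W2_sq_def by (rule INF_lower)

lemma W2_sq_lessE:
  assumes "W2_sq \<mu> \<nu> < u"
  obtains \<pi> where "\<pi> \<in> couplings \<mu> \<nu>" "(\<integral>\<^sup>+ (x, y). ennreal ((norm (x - y))\<^sup>2) \<partial>\<pi>) < u"
  using assms unfolding W2_sq_def INF_less_iff by blast

text \<open>Exchanging the coordinates of a coupling reverses the marginals and keeps the
  cost.\<close>

lemma W2_sq_le_swap: "W2_sq \<nu> \<mu> \<le> W2_sq \<mu> \<nu>"
proof -
  have "W2_sq \<nu> \<mu> \<le> (\<integral>\<^sup>+ (x, y). ennreal ((norm (x - y))\<^sup>2) \<partial>\<pi>)"
    if "\<pi> \<in> couplings \<mu> \<nu>" for \<pi>
  proof -
    have [measurable_cong]: "sets \<pi> = sets (borel \<Otimes>\<^sub>M borel)"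
      and d: "distr \<pi> borel fst = \<mu>" "distr \<pi> borel snd = \<nu>"
      using that by (auto simp: couplings_def)
    define \<pi>' where "\<pi>' = distr \<pi> (borel \<Otimes>\<^sub>M borel) prod.swap"
    have sw [measurable]: "prod.swap \<in> measurable \<pi> (borel \<Otimes>\<^sub>M borel)"
      unfolding prod.swap_def by measurable
    have "\<pi>' \<in> couplings \<nu> \<mu>"
      using d by (auto simp: couplings_def \<pi>'_def distr_distr comp_def)
    then have "W2_sq \<nu> \<mu> \<le> (\<integral>\<^sup>+ (x, y). ennreal ((norm (x - y))\<^sup>2) \<partial>\<pi>')"
      by (rule W2_sq_le)
    also have "\<dots> = (\<integral>\<^sup>+ (x, y). ennreal ((norm (x - y))\<^sup>2) \<partial>\<pi>)"
      unfolding \<pi>'_def by (subst nn_integral_distr) (auto simp: case_prod_beta intro!: nn_integral_cong arg_cong[OF norm_minus_commute])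
    finally show ?thesis .
  qed
  then show ?thesis
    unfolding W2_sq_def[of \<mu>] by (rule INF_greatest)
qed

lemma W2_commute: "W2 \<mu> \<nu> = W2 \<nu> \<mu>"
  unfolding W2_def using W2_sq_le_swap[of \<mu> \<nu>] W2_sq_le_swap[of \<nu> \<mu>] by simp

lemma W2_nonneg: "0 \<le> W2 \<mu> \<nu>"
  by (simp add: W2_def)

lemma W2_refl:
  assumes [measurable_cong, simp]: "sets \<mu> = sets borel"
  shows "W2 \<mu> \<mu> = 0"
proof -
  \<comment> \<open>The coupling on the diagonal moves nothing.\<close>
  define \<pi> where "\<pi> = distr \<mu> (borel \<Otimes>\<^sub>M borel) (\<lambda>x. (x, x))"
  have "distr \<mu> borel (\<lambda>x. x) = \<mu>"
    by (rule distr_id2) simp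
  then have "\<pi> \<in> couplings \<mu> \<mu>"
    by (auto simp: couplings_def \<pi>_def distr_distr comp_def)
  moreover have "(\<integral>\<^sup>+ (x, y). ennreal ((norm (x - y))\<^sup>2) \<partial>\<pi>) = 0"
    unfolding \<pi>_def by (subst nn_integral_distr) auto
  ultimately have "W2_sq \<mu> \<mu> \<le> 0"
    using W2_sq_le by metis
  then show ?thesis by (simp add: W2_def)
qed

text \<open>Cauchy-Schwarz with weights \<open>a\<close>, \<open>b\<close>, \<open>e\<close>; integrated with \<open>\<integral>u\<^sup>2 \<le> a\<^sup>2\<close> and \<open>\<integral>v\<^sup>2 \<le> b\<^sup>2\<close> it yields
  \<open>(a + b + e)\<^sup>2\<close> and replaces Minkowski's inequality.\<close>

lemma weighted_sum_square_le:
  fixes a b e u v w :: real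
  assumes "a > 0" "b > 0" "e > 0" "0 \<le> w" "w \<le> u + e + v"
  shows "w\<^sup>2 \<le> (a + b + e) * (u\<^sup>2 / a + v\<^sup>2 / b + e)"
proof -
  have "w\<^sup>2 \<le> (u + e + v)\<^sup>2"
    using assms by (intro power_mono) auto
  also have "\<dots> \<le> (a + b + e) * (u\<^sup>2 / a + v\<^sup>2 / b + e)"
  proof -
    \<comment> \<open>Lagrange's identity: the defect in Cauchy-Schwarz is a sum of squares, one for
      each pair of weights.\<close>
    have "(a + b + e) * (u\<^sup>2 / a + v\<^sup>2 / b + e) - (u + e + v)\<^sup>2
       = (b * u - a * v)\<^sup>2 / (a * b) + e * (u - a)\<^sup>2 / a + e * (v - b)\<^sup>2 / b"
      using assms by (simp add: field_simps power2_eq_square)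
    also have "\<dots> \<ge> 0" using assms by simp
    finally show ?thesis by simp
  qed
  finally show ?thesis .
qed

section \<open>Triangle inequality\<close>

text \<open>Strict bounds supply couplings even if the infima are not attained. Gluing them produces
  points \<open>x\<close>, \<open>y\<close>, \<open>y'\<close>, \<open>z\<close> with
  \<open>y\<close> and \<open>y'\<close> in one cell, so the path from \<open>x\<close> to
  \<open>z\<close> has only an extra jump of length at most \<open>e\<close>.\<close>

lemma W2_sq_glue:
  fixes \<mu> \<nu> \<rho> :: "'a::euclidean_space measure"
  assumes "prob_space \<mu>" "prob_space \<nu>"
    and a: "a > 0" "W2_sq \<mu> \<nu> < ennreal (a\<^sup>2)" and b: "b > 0" "W2_sq \<nu> \<rho> < ennreal (b\<^sup>2)"
    and e: "e > 0"
  shows "W2_sq \<mu> \<rho> \<le> ennreal ((a + b + e)\<^sup>2)"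
proof -
  obtain P where P: "P \<in> couplings \<mu> \<nu>" "(\<integral>\<^sup>+ (x, y). ennreal ((norm (x - y))\<^sup>2) \<partial>P) < ennreal (a\<^sup>2)"
    using W2_sq_lessE[OF a(2)] .
  obtain Q where Q: "Q \<in> couplings \<nu> \<rho>" "(\<integral>\<^sup>+ (x, y). ennreal ((norm (x - y))\<^sup>2) \<partial>Q) < ennreal (b\<^sup>2)"
    using W2_sq_lessE[OF b(2)] .
  interpret P: prob_space P using P(1) assms(1) by (rule prob_space_coupling)
  interpret Q: prob_space Q using Q(1) assms(2) by (rule prob_space_coupling)
  have [measurable_cong]: "sets P = sets (borel \<Otimes>\<^sub>M borel)" "sets Q = sets (borel \<Otimes>\<^sub>M borel)"
    and margP: "distr P borel fst = \<mu>" "distr P borel snd = \<nu>"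
    and margQ: "distr Q borel fst = \<nu>" "distr Q borel snd = \<rho>"
    using P(1) Q(1) by (auto simp: couplings_def)
  obtain q :: "'a \<Rightarrow> nat" where [measurable]: "q \<in> measurable borel (count_space UNIV)"
    and q: "\<And>x y. q x = q y \<Longrightarrow> norm (x - y) \<le> e"
    using countable_partition_small_diameter[OF e] by blast
  \<comment> \<open>The cell index of the middle point has the same law under \<open>P\<close> and
    \<open>Q\<close>, since both have the marginal \<open>\<nu>\<close> there.\<close>
  have "distr P (count_space UNIV) (\<lambda>w. q (snd w)) = distr (distr P borel snd) (count_space UNIV) q"
    by (subst distr_distr) (auto simp: comp_def)
  also have "\<dots> = distr (distr Q borel fst) (count_space UNIV) q"
    by (simp add: margP margQ)
  also have "\<dots> = distr Q (count_space UNIV) (\<lambda>w. q (fst w))"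
    by (subst distr_distr) (auto simp: comp_def)
  finally have law: "distr P (count_space UNIV) (\<lambda>w. q (snd w)) = distr Q (count_space UNIV) (\<lambda>w. q (fst w))" .
  obtain \<gamma> where [measurable_cong]: "sets \<gamma> = sets (P \<Otimes>\<^sub>M Q)"
    and dP: "distr \<gamma> P fst = P" and dQ: "distr \<gamma> Q snd = Q"
    and eq: "AE w in \<gamma>. q (snd (fst w)) = q (fst (snd w))"
    by (rule glue_along_discrete_maps[OF P.prob_space_axioms Q.prob_space_axioms _ _ law]) simp_all
  have [measurable]: "fst \<in> measurable \<gamma> P" "snd \<in> measurable \<gamma> Q"
    by measurable
  interpret \<gamma>: prob_space \<gamma>
    by (rule prob_space_distrD[of fst _ P]) (simp_all add: dP P.prob_space_axioms)
  \<comment> \<open>Forget both middle points and keep the outer pair \<open>(x, z)\<close>.\<close>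
  define \<pi> where "\<pi> = distr \<gamma> (borel \<Otimes>\<^sub>M borel) (\<lambda>w. (fst (fst w), snd (snd w)))"
  have "distr \<pi> borel fst = distr (distr \<gamma> P fst) borel fst"
    unfolding \<pi>_def by (subst (1 2) distr_distr) (auto simp: comp_def)
  moreover have "distr \<pi> borel snd = distr (distr \<gamma> Q snd) borel snd"
    unfolding \<pi>_def by (subst (1 2) distr_distr) (auto simp: comp_def)
  ultimately have "\<pi> \<in> couplings \<mu> \<rho>"
    by (simp add: couplings_def dP dQ margP margQ) (simp add: \<pi>_def)
  then have "W2_sq \<mu> \<rho> \<le> (\<integral>\<^sup>+ (x, y). ennreal ((norm (x - y))\<^sup>2) \<partial>\<pi>)"
    by (rule W2_sq_le)
  also have "\<dots> = (\<integral>\<^sup>+ w. ennreal ((norm (fst (fst w) - snd (snd w)))\<^sup>2) \<partial>\<gamma>)"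
    unfolding \<pi>_def by (subst nn_integral_distr) auto
  also have "\<dots> \<le> (\<integral>\<^sup>+ w. ennreal (a + b + e) * (ennreal (1 / a) * ennreal ((norm (fst (fst w) - snd (fst w)))\<^sup>2)
      + ennreal (1 / b) * ennreal ((norm (fst (snd w) - snd (snd w)))\<^sup>2) + ennreal e) \<partial>\<gamma>)"
  proof (rule nn_integral_mono_AE, use eq in eventually_elim)
    case (elim w)
    obtain x y y' z where w: "w = ((x, y), (y', z))" by (metis surj_pair)
    have "norm (x - z) \<le> norm (x - y) + norm (y - y') + norm (y' - z)"
      using norm_triangle_ineq[of "x - y" "y - z"]
        norm_triangle_ineq[of "y - y'" "y' - z"] by simp
    moreover have "norm (y - y') \<le> e" using elim q w by simp
    ultimately have "norm (x - z) \<le> norm (x - y) + e + norm (y' - z)" by simp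
    from weighted_sum_square_le[OF a(1) b(1) e norm_ge_zero this]
    show ?case
      using a(1) b(1) e by (simp add: w flip: ennreal_mult ennreal_plus)
  qed
  also have "\<dots> = ennreal (a + b + e) * (ennreal (1 / a) * (\<integral>\<^sup>+ w. ennreal ((norm (fst (fst w) - snd (fst w)))\<^sup>2) \<partial>\<gamma>)
      + ennreal (1 / b) * (\<integral>\<^sup>+ w. ennreal ((norm (fst (snd w) - snd (snd w)))\<^sup>2) \<partial>\<gamma>) + ennreal e)"
    by (simp add: nn_integral_add nn_integral_cmult \<gamma>.emeasure_space_1)
  also have "(\<integral>\<^sup>+ w. ennreal ((norm (fst (fst w) - snd (fst w)))\<^sup>2) \<partial>\<gamma>)
      = (\<integral>\<^sup>+ (x, y). ennreal ((norm (x - y))\<^sup>2) \<partial>distr \<gamma> P fst)"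
    by (subst nn_integral_distr) (auto simp: case_prod_beta)
  also have "(\<integral>\<^sup>+ w. ennreal ((norm (fst (snd w) - snd (snd w)))\<^sup>2) \<partial>\<gamma>)
      = (\<integral>\<^sup>+ (x, y). ennreal ((norm (x - y))\<^sup>2) \<partial>distr \<gamma> Q snd)"
    by (subst nn_integral_distr) (auto simp: case_prod_beta)
  \<comment> \<open>The weights are chosen so that the second factor becomes
    \<open>a + b + e\<close> as well once the costs are replaced by \<open>a\<^sup>2\<close> and
    \<open>b\<^sup>2\<close>.\<close>
  also have "ennreal (a + b + e) * (ennreal (1 / a) * (\<integral>\<^sup>+ (x, y). ennreal ((norm (x - y))\<^sup>2) \<partial>distr \<gamma> P fst)
      + ennreal (1 / b) * (\<integral>\<^sup>+ (x, y). ennreal ((norm (x - y))\<^sup>2) \<partial>distr \<gamma> Q snd) + ennreal e)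
    \<le> ennreal (a + b + e) * (ennreal (1 / a) * ennreal (a\<^sup>2) + ennreal (1 / b) * ennreal (b\<^sup>2) + ennreal e)"
    unfolding dP dQ using less_imp_le[OF P(2)] less_imp_le[OF Q(2)] by (intro mult_left_mono add_mono order_refl zero_le)
  also have "\<dots> = ennreal ((a + b + e)\<^sup>2)"
    using a(1) b(1) e by (simp add: power2_eq_square flip: ennreal_mult ennreal_plus)
  finally show ?thesis .
qed

text \<open>The slack \<open>e\<close> is split in three: one third is added to each distance,
  making the bounds positive and strict, and one third is the diameter of the cells.\<close>

lemma W2_triangle:
  fixes \<mu> \<nu> \<rho> :: "'a::euclidean_space measure"
  assumes "prob_space \<mu>" "prob_space \<nu>" "W2_sq \<mu> \<nu> < \<infinity>" "W2_sq \<nu> \<rho> < \<infinity>"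
  shows "W2 \<mu> \<rho> \<le> W2 \<mu> \<nu> + W2 \<nu> \<rho>"
proof (rule field_le_epsilon)
  fix e :: real assume "e > 0"
  define a b where "a = W2 \<mu> \<nu> + e / 3" and "b = W2 \<nu> \<rho> + e / 3"
  have less: "W2_sq \<mu>' \<nu>' < ennreal ((W2 \<mu>' \<nu>' + e / 3)\<^sup>2)"
    if "W2_sq \<mu>' \<nu>' < \<infinity>" for \<mu>' \<nu>' :: "'a measure"
  proof -
    \<comment> \<open>Finiteness is essential: an infinite cost would give \<open>W2\<close> the
      value 0.\<close>
    have "W2_sq \<mu>' \<nu>' = ennreal ((W2 \<mu>' \<nu>')\<^sup>2)"
      using that by (simp add: W2_def)
    also have "\<dots> < ennreal ((W2 \<mu>' \<nu>' + e / 3)\<^sup>2)"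
      using \<open>e > 0\<close> W2_nonneg[of \<mu>' \<nu>'] by (intro ennreal_lessI) (auto intro!: power_strict_mono add_nonneg_pos)
    finally show ?thesis .
  qed
  have pos: "a > 0" "b > 0"
    using \<open>e > 0\<close> W2_nonneg[of \<mu> \<nu>] W2_nonneg[of \<nu> \<rho>] by (simp_all add: a_def b_def)
  have "W2_sq \<mu> \<rho> \<le> ennreal ((a + b + e / 3)\<^sup>2)"
    using pos \<open>e > 0\<close> less[OF assms(3)] less[OF assms(4)]
    by (intro W2_sq_glue[OF assms(1,2)]) (auto simp: a_def b_def)
  then have "enn2real (W2_sq \<mu> \<rho>) \<le> (a + b + e / 3)\<^sup>2"
    by (intro enn2real_leI) auto
  then have "W2 \<mu> \<rho> \<le> a + b + e / 3"
    unfolding W2_def using pos \<open>e > 0\<close> by (intro real_le_lsqrt) auto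
  then show "W2 \<mu> \<rho> \<le> W2 \<mu> \<nu> + W2 \<nu> \<rho> + e"
    by (simp add: a_def b_def)
qed

section \<open>Vanishing distance forces equality\<close>

text \<open>A Markov-type estimate: mass leaving \<open>A\<close> for the complement of
  \<open>N k\<close> travels farther than \<open>d = 1 / Suc k\<close>, hence costs at least
  \<open>d\<^sup>2\<close> per unit. Arbitrarily cheap couplings exclude any such loss, and the
  neighbourhoods \<open>N k\<close> decrease to the closed set \<open>A\<close>.\<close>

lemma emeasure_closed_le_if_W2_sq_eq_0:
  fixes \<mu> \<nu> :: "'a::euclidean_space measure"
  assumes "prob_space \<mu>" "prob_space \<nu>" and [measurable_cong, simp]: "sets \<mu> = sets borel" "sets \<nu> = sets borel"
    and 0: "W2_sq \<mu> \<nu> = 0" and A: "closed A"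
  shows "emeasure \<mu> A \<le> emeasure \<nu> A"
\<comment> \<open>The empty set is treated apart because \<open>infdist y {} = 0\<close> would make
  every \<open>N k\<close> the whole space.\<close>
proof (cases "A = {}")
  case False
  interpret \<nu>: prob_space \<nu> by fact
  define N where "N k = {y. infdist y A \<le> 1 / Suc k}" for k
  have [measurable]: "N k \<in> sets borel" "A \<in> sets borel" for k
    using A by (auto simp: N_def intro!: borel_closed closed_Collect_le continuous_on_infdist continuous_on_id continuous_on_const)
  have step: "emeasure \<mu> A \<le> emeasure \<nu> (N k)" for k
  proof (rule ennreal_le_epsilon)
    fix e :: real assume e: "e > 0"
    define d where "d = 1 / real (Suc k)"
    have d: "d > 0" by (simp add: d_def)
    \<comment> \<open>With this cost, at most mass \<open>e\<close> can travel a distance above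
      \<open>d\<close>.\<close>
    have "W2_sq \<mu> \<nu> < ennreal (e * d\<^sup>2)"
      using 0 e d by simp
    then obtain \<pi> where \<pi>: "\<pi> \<in> couplings \<mu> \<nu>"
      and cost: "(\<integral>\<^sup>+ (x, y). ennreal ((norm (x - y))\<^sup>2) \<partial>\<pi>) < ennreal (e * d\<^sup>2)"
      by (rule W2_sq_lessE)
    have [measurable_cong]: "sets \<pi> = sets (borel \<Otimes>\<^sub>M borel)"
      and m: "distr \<pi> borel fst = \<mu>" "distr \<pi> borel snd = \<nu>"
      using \<pi> by (auto simp: couplings_def)
    have "emeasure \<mu> A = (\<integral>\<^sup>+ w. indicator A (fst w) \<partial>\<pi>)"
      unfolding m(1)[symmetric] by (subst nn_integral_indicator[symmetric], simp, subst nn_integral_distr) auto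
    \<comment> \<open>Either the endpoint lies in \<open>N k\<close>, or the rescaled cost is at
      least 1, or the starting point is outside \<open>A\<close>.\<close>
    also have "\<dots> \<le> (\<integral>\<^sup>+ w. indicator (N k) (snd w) + ennreal (1 / d\<^sup>2) * (case w of (x, y) \<Rightarrow> ennreal ((norm (x - y))\<^sup>2)) \<partial>\<pi>)"
    proof (rule nn_integral_mono)
      fix w :: "'a \<times> 'a"
      obtain x y where w: "w = (x, y)" by (cases w)
      show "indicator A (fst w) \<le> indicator (N k) (snd w) + ennreal (1 / d\<^sup>2) * (case w of (x, y) \<Rightarrow> ennreal ((norm (x - y))\<^sup>2))"
      proof (cases "x \<in> A \<and> y \<notin> N k")
        case True
        then have "d < norm (x - y)"
          using infdist_le[of x A y] by (auto simp: N_def d_def dist_norm norm_minus_commute)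
        then have "1 \<le> 1 / d\<^sup>2 * (norm (x - y))\<^sup>2"
          using d by (simp add: power_mono)
        then have "ennreal 1 \<le> ennreal (1 / d\<^sup>2 * (norm (x - y))\<^sup>2)"
          by (rule ennreal_leI)
        then show ?thesis
          using True by (simp add: w del: times_divide_eq_left flip: ennreal_mult)
      qed (auto simp: w indicator_def)
    qed
    also have "\<dots> = (\<integral>\<^sup>+ w. indicator (N k) (snd w) \<partial>\<pi>) + ennreal (1 / d\<^sup>2) * (\<integral>\<^sup>+ (x, y). ennreal ((norm (x - y))\<^sup>2) \<partial>\<pi>)"
      by (subst nn_integral_add) (auto simp: nn_integral_cmult)
    also have "(\<integral>\<^sup>+ w. indicator (N k) (snd w) \<partial>\<pi>) = emeasure \<nu> (N k)"
      unfolding m(2)[symmetric] by (subst nn_integral_indicator[symmetric], simp, subst nn_integral_distr) auto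
    also have "ennreal (1 / d\<^sup>2) * (\<integral>\<^sup>+ (x, y). ennreal ((norm (x - y))\<^sup>2) \<partial>\<pi>) \<le> ennreal (1 / d\<^sup>2) * ennreal (e * d\<^sup>2)"
      using cost by (intro mult_left_mono) auto
    also have "\<dots> = ennreal e"
      using d e by (simp flip: ennreal_mult)
    finally show "emeasure \<mu> A \<le> emeasure \<nu> (N k) + ennreal e"
      by (simp add: add_left_mono)
  qed
  \<comment> \<open>Continuity from above, available because \<open>\<nu>\<close> is finite.\<close>
  have "emeasure \<mu> A \<le> (INF k. emeasure \<nu> (N k))"
    using step by (intro INF_greatest) auto
  also have "\<dots> = emeasure \<nu> (\<Inter>k. N k)"
  proof (rule INF_emeasure_decseq)
    have "N n \<subseteq> N m" if "m \<le> n" for m n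
    proof -
      have "1 / real (Suc n) \<le> 1 / real (Suc m)"
        using that by (intro divide_left_mono) auto
      then show ?thesis
        unfolding N_def using order_trans by blast
    qed
    then show "decseq N"
      by (simp add: decseq_def)
  qed auto
  also have "(\<Inter>k. N k) = A"
  proof -
    have "y \<in> A" if "\<And>k. infdist y A \<le> 1 / Suc k" for y
    proof -
      have "infdist y A \<le> 0"
        by (rule LIMSEQ_le_const[OF LIMSEQ_inverse_real_of_nat])
           (use that in \<open>auto simp: inverse_eq_divide\<close>)
      then show ?thesis
        using A False in_closed_iff_infdist_zero[of A y] infdist_nonneg[of y A] by auto
    qed
    then show ?thesis by (auto simp: N_def)
  qed
  finally show ?thesis .
qed simp

text \<open>By symmetry the two measures agree on closed sets, which are stable under intersection,
  generate the Borel sets and include the whole space.\<close>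

lemma W2_sq_eq_0_imp_eq:
  fixes \<mu> \<nu> :: "'a::euclidean_space measure"
  assumes "prob_space \<mu>" "prob_space \<nu>" "sets \<mu> = sets borel" "sets \<nu> = sets borel" "W2_sq \<mu> \<nu> = 0"
  shows "\<mu> = \<nu>"
proof -
  interpret \<mu>: prob_space \<mu> by fact
  have 0: "W2_sq \<nu> \<mu> = 0"
    using assms(5) W2_sq_le_swap[of \<nu> \<mu>] by simp
  have eq: "emeasure \<mu> A = emeasure \<nu> A" if "closed A" for A
    using assms 0 that by (intro antisym emeasure_closed_le_if_W2_sq_eq_0) auto
  show ?thesis
    using eq assms(3,4) \<mu>.emeasure_finite[of UNIV]
    by (intro measure_eqI_generator_eq[where E="Collect closed" and \<Omega>=UNIV and A="\<lambda>_. UNIV"])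
       (auto simp: Int_stable_def borel_eq_closed)
qed

section \<open>Finite cost on bounded sets\<close>

lemma W2_sq_finite_if_bounded:
  fixes \<mu> \<nu> :: "'a::euclidean_space measure"
  assumes "prob_space \<mu>" "prob_space \<nu>" and [measurable_cong, simp]: "sets \<mu> = sets borel" "sets \<nu> = sets borel"
    and "bounded \<Omega>" and \<Omega>: "AE x in \<mu>. x \<in> \<Omega>" "AE x in \<nu>. x \<in> \<Omega>"
  shows "W2_sq \<mu> \<nu> < \<infinity>"
proof -
  interpret \<mu>: prob_space \<mu> by fact
  interpret \<nu>: prob_space \<nu> by fact
  interpret pair_prob_space \<mu> \<nu> ..
  obtain B where B: "B > 0" "\<And>x. x \<in> \<Omega> \<Longrightarrow> norm x \<le> B"
    using \<open>bounded \<Omega>\<close> bounded_pos by blast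
  \<comment> \<open>Gluing along constant maps imposes no constraint on the pair and serves only to
    produce a coupling. Its cost is bounded by the squared diameter bound
    \<open>(2 * B)\<^sup>2\<close>.\<close>
  have "distr \<mu> (count_space UNIV) (\<lambda>_. 0::nat) = distr \<nu> (count_space UNIV) (\<lambda>_. 0)"
    by simp
  then obtain \<pi> where s: "sets \<pi> = sets (\<mu> \<Otimes>\<^sub>M \<nu>)" and d: "distr \<pi> \<mu> fst = \<mu>" "distr \<pi> \<nu> snd = \<nu>"
    by (rule glue_along_discrete_maps[OF assms(1,2), rotated 2]) auto
  have sb [measurable_cong]: "sets \<pi> = sets (borel \<Otimes>\<^sub>M borel)"
    unfolding s by (intro sets_pair_measure_cong) auto
  have m [measurable]: "fst \<in> measurable \<pi> \<mu>" "snd \<in> measurable \<pi> \<nu>"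
    by measurable
  interpret \<pi>: prob_space \<pi>
    by (rule prob_space_distrD[OF m(1)]) (simp add: d assms(1))
  have "distr \<pi> borel fst = distr \<pi> \<mu> fst" "distr \<pi> borel snd = distr \<pi> \<nu> snd"
    by (auto intro!: distr_cong)
  then have "\<pi> \<in> couplings \<mu> \<nu>"
    using sb d by (simp add: couplings_def)
  then have "W2_sq \<mu> \<nu> \<le> (\<integral>\<^sup>+ (x, y). ennreal ((norm (x - y))\<^sup>2) \<partial>\<pi>)"
    by (rule W2_sq_le)
  also have "\<dots> \<le> (\<integral>\<^sup>+ w. ennreal ((2 * B)\<^sup>2) \<partial>\<pi>)"
  proof (rule nn_integral_mono_AE)
    have "AE w in \<pi>. fst w \<in> \<Omega>" "AE w in \<pi>. snd w \<in> \<Omega>"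
      using \<Omega> AE_distrD[OF m(1), of "\<lambda>x. x \<in> \<Omega>", unfolded d]
        AE_distrD[OF m(2), of "\<lambda>x. x \<in> \<Omega>", unfolded d] by blast+
    then show "AE w in \<pi>. (case w of (x, y) \<Rightarrow> ennreal ((norm (x - y))\<^sup>2)) \<le> ennreal ((2 * B)\<^sup>2)"
    proof eventually_elim
      case (elim w)
      have "norm (fst w - snd w) \<le> 2 * B"
        using B(2)[OF elim(1)] B(2)[OF elim(2)] norm_triangle_ineq4[of "fst w" "snd w"] by simp
      then have "ennreal ((norm (fst w - snd w))\<^sup>2) \<le> ennreal ((2 * B)\<^sup>2)"
        by (intro ennreal_leI power_mono) auto
      then show ?case by (simp add: case_prod_beta)
    qed
  qed
  also have "\<dots> < \<infinity>"
    by (simp add: \<pi>.emeasure_space_1)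
  finally show ?thesis .
qed

section \<open>Normalized densities\<close>

text \<open>Nonempty open sets have positive Lebesgue measure, so an almost-everywhere statement
  that fails throughout such a set is contradictory.\<close>

lemma AE_lborel_not_in_open:
  fixes U :: "'a::euclidean_space set"
  assumes "open U" "AE x in lborel. x \<notin> U"
  shows "U = {}"
proof -
  have "U \<in> null_sets lborel"
    using assms by (subst AE_iff_null_sets) auto
  then have "negligible U"
    by (simp add: negligible_iff_null_sets null_sets_completionI)
  then show ?thesis
    using assms(1) open_not_negligible by blast
qed

locale sigma_normalization =
  fixes \<Omega> :: "'a::euclidean_space set" and \<sigma> :: "real \<Rightarrow> real" and c :: real
  assumes nonempty: "\<Omega> \<noteq> {}" and open_domain: "open \<Omega>" and bounded_domain: "bounded \<Omega>"
    and \<sigma>_pos: "\<sigma> x > 0" and inj_\<sigma>: "inj \<sigma>" and c_nonneg: "c \<ge> 0"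
begin

lemma numerator_pos: "\<sigma> x + c > 0"
  using \<sigma>_pos[of x] c_nonneg by simp

lemma domain_measurable [measurable]: "\<Omega> \<in> sets borel"
  using open_domain by simp

text \<open>A nonnegative integrand has integral 0 only if it vanishes almost everywhere, but this
  one is strictly positive on the nonempty open set \<open>\<Omega>\<close>.\<close>

lemma normalizer_pos:
  assumes "f \<in> signed_densities \<Omega> \<sigma> c"
  shows "(LINT \<tau>:\<Omega>|lborel. \<sigma> (f \<tau>) + c) > 0"
proof -
  let ?F = "\<lambda>t. indicator \<Omega> t *\<^sub>R (\<sigma> (f t) + c)"
  have int: "integrable lborel ?F"
    using assms by (simp add: signed_densities_def set_integrable_def)
  have nonneg: "?F t \<ge> 0" for t
    using numerator_pos[of "f t"] by (simp add: indicator_def)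
  have "\<not> (AE t in lborel. ?F t = 0)"
  proof
    assume "AE t in lborel. ?F t = 0"
    then have "AE t in lborel. t \<notin> \<Omega>"
      by eventually_elim (use numerator_pos in \<open>auto simp: indicator_def order_less_le\<close>)
    then show False
      using AE_lborel_not_in_open open_domain nonempty by blast
  qed
  then have "integral\<^sup>L lborel ?F \<noteq> 0"
    using integral_nonneg_eq_0_iff_AE[OF int] nonneg by simp
  moreover have "integral\<^sup>L lborel ?F \<ge> 0"
    using nonneg by simp
  ultimately show ?thesis
    by (simp add: set_lebesgue_integral_def)
qed

text \<open>Representatives are arbitrary outside \<open>\<Omega>\<close>, so \<open>P_sigma\<close>
  alone may fail to be measurable. Inside \<open>ennreal\<close> the indicator yields exactly the
  function whose measurability follows from set integrability.\<close>

lemma P_sigma_measure_eq_density: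
  "P_sigma_measure \<Omega> \<sigma> c f = density lborel (\<lambda>t. ennreal (indicator \<Omega> t *\<^sub>R P_sigma \<Omega> \<sigma> c f t))"
  unfolding P_sigma_measure_def by (intro arg_cong[where f="density lborel"]) (auto simp: indicator_def)

lemma P_sigma_pos:
  assumes "f \<in> signed_densities \<Omega> \<sigma> c"
  shows "P_sigma \<Omega> \<sigma> c f t > 0"
  unfolding P_sigma_def using normalizer_pos[OF assms] numerator_pos by simp

lemma set_integrable_P_sigma:
  assumes "f \<in> signed_densities \<Omega> \<sigma> c"
  shows "set_integrable lborel \<Omega> (P_sigma \<Omega> \<sigma> c f)"
  unfolding P_sigma_def using assms by (intro set_integrable_divide) (simp add: signed_densities_def)

lemma measurable_P_sigma:
  assumes "f \<in> signed_densities \<Omega> \<sigma> c"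
  shows "(\<lambda>t. indicator \<Omega> t *\<^sub>R P_sigma \<Omega> \<sigma> c f t) \<in> borel_measurable lborel"
  using set_integrable_P_sigma[OF assms] unfolding set_integrable_def by (rule borel_measurable_integrable)

lemma prob_space_P_sigma_measure:
  assumes "f \<in> signed_densities \<Omega> \<sigma> c"
  shows "prob_space (P_sigma_measure \<Omega> \<sigma> c f)"
proof
  have "emeasure (P_sigma_measure \<Omega> \<sigma> c f) UNIV
      = (\<integral>\<^sup>+ t. ennreal (indicator \<Omega> t *\<^sub>R P_sigma \<Omega> \<sigma> c f t) \<partial>lborel)"
    unfolding P_sigma_measure_eq_density
    by (subst emeasure_density[OF measurable_compose[OF measurable_P_sigma[OF assms] measurable_ennreal]]) auto
  also have "\<dots> = ennreal (LINT t:\<Omega>|lborel. P_sigma \<Omega> \<sigma> c f t)"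
    unfolding set_lebesgue_integral_def
    using set_integrable_P_sigma[OF assms] P_sigma_pos[OF assms]
    by (intro nn_integral_eq_integral) (auto simp: set_integrable_def less_imp_le)
  also have "(LINT t:\<Omega>|lborel. P_sigma \<Omega> \<sigma> c f t) = 1"
    unfolding P_sigma_def using normalizer_pos[OF assms] by simp
  finally show "emeasure (P_sigma_measure \<Omega> \<sigma> c f) (space (P_sigma_measure \<Omega> \<sigma> c f)) = 1"
    by (simp add: P_sigma_measure_def)
qed

lemma sets_P_sigma_measure [simp]: "sets (P_sigma_measure \<Omega> \<sigma> c f) = sets borel"
  by (simp add: P_sigma_measure_def)

lemma W2_sq_P_sigma_measure_finite:
  assumes "f \<in> signed_densities \<Omega> \<sigma> c" "g \<in> signed_densities \<Omega> \<sigma> c"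
  shows "W2_sq (P_sigma_measure \<Omega> \<sigma> c f) (P_sigma_measure \<Omega> \<sigma> c g) < \<infinity>"
proof -
  have "AE t in P_sigma_measure \<Omega> \<sigma> c h. t \<in> \<Omega>" if "h \<in> signed_densities \<Omega> \<sigma> c" for h
    unfolding P_sigma_measure_eq_density
    by (subst AE_density[OF measurable_compose[OF measurable_P_sigma[OF that] measurable_ennreal]])
      (auto simp: indicator_def split: if_splits)
  then show ?thesis
    using assms bounded_domain prob_space_P_sigma_measure
    by (intro W2_sq_finite_if_bounded[where \<Omega>=\<Omega>]) auto
qed

section \<open>Normalized measures and almost-everywhere classes\<close>

lemma P_sigma_measure_cong_AE:
  assumes "(f, g) \<in> ae_rel \<Omega> \<sigma> c"
  shows "P_sigma_measure \<Omega> \<sigma> c f = P_sigma_measure \<Omega> \<sigma> c g"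
proof -
  have f: "f \<in> signed_densities \<Omega> \<sigma> c" and g: "g \<in> signed_densities \<Omega> \<sigma> c"
    and ae: "AE t\<in>\<Omega> in lborel. f t = g t"
    using assms by (auto simp: ae_rel_def)
  have m: "(\<lambda>t. indicator \<Omega> t *\<^sub>R (\<sigma> (h t) + c)) \<in> borel_measurable lborel"
    if "h \<in> signed_densities \<Omega> \<sigma> c" for h
    using that by (auto simp: signed_densities_def set_integrable_def)
  have "(LINT \<tau>:\<Omega>|lborel. \<sigma> (f \<tau>) + c) = (LINT \<tau>:\<Omega>|lborel. \<sigma> (g \<tau>) + c)"
    unfolding set_lebesgue_integral_def
    using ae by (intro integral_cong_AE m f g) (auto simp: indicator_def)
  then have "AE t in lborel. ennreal (indicator \<Omega> t *\<^sub>R P_sigma \<Omega> \<sigma> c f t)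
      = ennreal (indicator \<Omega> t *\<^sub>R P_sigma \<Omega> \<sigma> c g t)"
    using ae by (auto simp: P_sigma_def indicator_def)
  then show ?thesis
    unfolding P_sigma_measure_eq_density
    by (intro density_cong measurable_compose[OF measurable_P_sigma measurable_ennreal] f g)
qed

text \<open>A compact support cannot exhaust the bounded open set \<open>\<Omega>\<close>, so two densities vanish together
  on a set of positive measure; there the two normalizations can be compared.\<close>

lemma common_zero_set:
  assumes "f \<in> signed_densities \<Omega> \<sigma> c" "g \<in> signed_densities \<Omega> \<sigma> c"
  obtains U where "open U" "U \<noteq> {}" "U \<subseteq> \<Omega>"
    "AE t\<in>U in lborel. f t = 0" "AE t\<in>U in lborel. g t = 0"
proof -
  let ?K = "density_support \<Omega> f \<union> density_support \<Omega> g"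
  have "compact ?K"
    using assms by (auto simp: signed_densities_def)
  \<comment> \<open>Otherwise \<open>\<Omega>\<close> would be both compact and open in Euclidean
    space, hence empty.\<close>
  then have "?K \<noteq> \<Omega>"
    using open_domain nonempty compact_open[of \<Omega>] by auto
  moreover have "?K \<subseteq> \<Omega>"
    by (auto simp: density_support_def)
  ultimately obtain x where x: "x \<in> \<Omega>" "x \<notin> density_support \<Omega> f" "x \<notin> density_support \<Omega> g"
    by blast
  then obtain U V where U: "open U" "x \<in> U" "AE y\<in>\<Omega> \<inter> U in lborel. f y = 0"
    and V: "open V" "x \<in> V" "AE y\<in>\<Omega> \<inter> V in lborel. g y = 0"
    by (auto simp: density_support_def)
  show ?thesis
  proof
    show "open (\<Omega> \<inter> U \<inter> V)" "\<Omega> \<inter> U \<inter> V \<noteq> {}" "\<Omega> \<inter> U \<inter> V \<subseteq> \<Omega>"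
      using U V x open_domain by auto
    show "AE t\<in>\<Omega> \<inter> U \<inter> V in lborel. f t = 0"
      using U(3) by eventually_elim auto
    show "AE t\<in>\<Omega> \<inter> U \<inter> V in lborel. g t = 0"
      using V(3) by eventually_elim auto
  qed
qed

text \<open>Equality of measures determines the numerators only up to the ratio of the normalizers.
  On the common zero set both numerators equal the positive constant \<open>\<sigma> 0 + c\<close>,
  so this ratio is 1 and injectivity of \<open>\<sigma>\<close> applies.\<close>

lemma P_sigma_measure_inject:
  assumes f: "f \<in> signed_densities \<Omega> \<sigma> c" and g: "g \<in> signed_densities \<Omega> \<sigma> c"
    and eq: "P_sigma_measure \<Omega> \<sigma> c f = P_sigma_measure \<Omega> \<sigma> c g"
  shows "(f, g) \<in> ae_rel \<Omega> \<sigma> c"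
proof -
  define Zf Zg where "Zf = (LINT \<tau>:\<Omega>|lborel. \<sigma> (f \<tau>) + c)" and "Zg = (LINT \<tau>:\<Omega>|lborel. \<sigma> (g \<tau>) + c)"
  have Z: "Zf > 0" "Zg > 0"
    unfolding Zf_def Zg_def using f g by (auto intro: normalizer_pos)
  have "AE t in lborel. ennreal (indicator \<Omega> t *\<^sub>R P_sigma \<Omega> \<sigma> c f t)
      = ennreal (indicator \<Omega> t *\<^sub>R P_sigma \<Omega> \<sigma> c g t)"
    using eq unfolding P_sigma_measure_eq_density
    by (rule sigma_finite_measure.density_unique[OF sigma_finite_lborel, rotated 2])
       (intro measurable_compose[OF measurable_P_sigma measurable_ennreal] f g)+
  then have "AE t\<in>\<Omega> in lborel. P_sigma \<Omega> \<sigma> c f t = P_sigma \<Omega> \<sigma> c g t"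
    \<comment> \<open>Positivity permits removing \<open>ennreal\<close>, which sends all negative
      reals to 0.\<close>
    by eventually_elim (use P_sigma_pos[OF f] P_sigma_pos[OF g] in \<open>auto simp: less_imp_le\<close>)
  then have quot: "AE t\<in>\<Omega> in lborel. (\<sigma> (f t) + c) / Zf = (\<sigma> (g t) + c) / Zg"
    by (simp add: P_sigma_def Zf_def Zg_def)
  obtain U where U: "open U" "U \<noteq> {}" "U \<subseteq> \<Omega>"
    and 0: "AE t\<in>U in lborel. f t = 0" "AE t\<in>U in lborel. g t = 0"
    using common_zero_set[OF f g] .
  have "Zf = Zg"
  proof (rule ccontr)
    assume "Zf \<noteq> Zg"
    \<comment> \<open>Different normalizers contradict the quotient identity at almost every point
      of \<open>U\<close>, so \<open>U\<close> would be null although it is open and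
      nonempty.\<close>
    have "AE t in lborel. t \<notin> U"
      using quot 0
    proof eventually_elim
      case (elim t)
      show ?case
      proof
        assume "t \<in> U"
        then have "(\<sigma> 0 + c) / Zf = (\<sigma> 0 + c) / Zg"
          using elim U(3) by auto
        then show False
          using \<open>Zf \<noteq> Zg\<close> Z numerator_pos[of 0] by (simp add: field_simps)
      qed
    qed
    then show False
      using AE_lborel_not_in_open U by blast
  qed
  then have "AE t\<in>\<Omega> in lborel. f t = g t"
    using quot Z inj_\<sigma> by (auto simp: inj_eq)
  then show ?thesis
    using f g by (simp add: ae_rel_def)
qed

lemma W_sigma_eq_0_iff:
  assumes f: "f \<in> signed_densities \<Omega> \<sigma> c" and g: "g \<in> signed_densities \<Omega> \<sigma> c"
  shows "W_sigma \<Omega> \<sigma> c f g = 0 \<longleftrightarrow> (f, g) \<in> ae_rel \<Omega> \<sigma> c"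
proof
  assume "W_sigma \<Omega> \<sigma> c f g = 0"
  then have "enn2real (W2_sq (P_sigma_measure \<Omega> \<sigma> c f) (P_sigma_measure \<Omega> \<sigma> c g)) = 0"
    unfolding W_sigma_def W2_def real_sqrt_eq_zero_cancel_iff .
  \<comment> \<open>\<open>enn2real\<close> also vanishes at infinity; finiteness of the cost rules
    that out.\<close>
  then have "W2_sq (P_sigma_measure \<Omega> \<sigma> c f) (P_sigma_measure \<Omega> \<sigma> c g) = 0"
    using W2_sq_P_sigma_measure_finite[OF f g] unfolding enn2real_eq_0_iff by (auto simp: less_top)
  then have "P_sigma_measure \<Omega> \<sigma> c f = P_sigma_measure \<Omega> \<sigma> c g"
    by (intro W2_sq_eq_0_imp_eq prob_space_P_sigma_measure f g sets_P_sigma_measure)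
  then show "(f, g) \<in> ae_rel \<Omega> \<sigma> c"
    by (rule P_sigma_measure_inject[OF f g])
next
  assume "(f, g) \<in> ae_rel \<Omega> \<sigma> c"
  then have "P_sigma_measure \<Omega> \<sigma> c f = P_sigma_measure \<Omega> \<sigma> c g"
    by (rule P_sigma_measure_cong_AE)
  then show "W_sigma \<Omega> \<sigma> c f g = 0"
    by (simp add: W_sigma_def W2_refl)
qed

section \<open>The metric on the quotient\<close>

lemma equiv_ae_rel: "equiv (signed_densities \<Omega> \<sigma> c) (ae_rel \<Omega> \<sigma> c)"
proof (rule equivI)
  show "trans (ae_rel \<Omega> \<sigma> c)"
  proof (rule transI)
    fix f g h assume "(f, g) \<in> ae_rel \<Omega> \<sigma> c" "(g, h) \<in> ae_rel \<Omega> \<sigma> c"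
    moreover from this have "AE t\<in>\<Omega> in lborel. f t = g t" "AE t\<in>\<Omega> in lborel. g t = h t"
      by (simp_all add: ae_rel_def)
    then have "AE t\<in>\<Omega> in lborel. f t = h t"
      by eventually_elim simp
    ultimately show "(f, h) \<in> ae_rel \<Omega> \<sigma> c"
      by (simp add: ae_rel_def)
  qed
  show "sym (ae_rel \<Omega> \<sigma> c)"
    by (rule symI) (simp add: ae_rel_def eq_commute)
  show "refl_on (signed_densities \<Omega> \<sigma> c) (ae_rel \<Omega> \<sigma> c)"
    by (rule refl_onI) (simp add: ae_rel_def)
qed (auto simp: ae_rel_def)

lemma W_sigma_respects2: "W_sigma \<Omega> \<sigma> c respects2 ae_rel \<Omega> \<sigma> c"
proof -
  have "W_sigma \<Omega> \<sigma> c f g = W_sigma \<Omega> \<sigma> c f' g'"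
    if "(f, f') \<in> ae_rel \<Omega> \<sigma> c" "(g, g') \<in> ae_rel \<Omega> \<sigma> c" for f f' g g'
    using P_sigma_measure_cong_AE[OF that(1)] P_sigma_measure_cong_AE[OF that(2)]
    by (simp add: W_sigma_def)
  then show ?thesis
    unfolding congruent2_def by blast
qed

lemma Metric_space_W_sigma_class: "Metric_space (P_s \<Omega> \<sigma> c) (W_sigma_class \<Omega> \<sigma> c)"
proof (rule Metric_space.intro)
  \<comment> \<open>Equivalence classes are nonempty, so the choice operator returns a genuine
    representative.\<close>
  have some: "(SOME f. f \<in> F) \<in> F" "(SOME f. f \<in> F) \<in> signed_densities \<Omega> \<sigma> c" if "F \<in> P_s \<Omega> \<sigma> c" for F
  proof -
    have F: "F \<in> signed_densities \<Omega> \<sigma> c // ae_rel \<Omega> \<sigma> c"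
      using that by (simp add: P_s_def)
    show "(SOME f. f \<in> F) \<in> F"
      using in_quotient_imp_non_empty[OF equiv_ae_rel F] by (simp add: some_in_eq)
    then show "(SOME f. f \<in> F) \<in> signed_densities \<Omega> \<sigma> c"
      using in_quotient_imp_subset[OF equiv_ae_rel F] by blast
  qed
  show "0 \<le> W_sigma_class \<Omega> \<sigma> c F G" for F G
    by (simp add: W_sigma_class_def W_sigma_def W2_nonneg)
  show "W_sigma_class \<Omega> \<sigma> c F G = W_sigma_class \<Omega> \<sigma> c G F" for F G
    by (simp add: W_sigma_class_def W_sigma_def W2_commute)
  \<comment> \<open>Distance 0 means related representatives, which means equal classes.\<close>
  show "W_sigma_class \<Omega> \<sigma> c F G = 0 \<longleftrightarrow> F = G" if "F \<in> P_s \<Omega> \<sigma> c" "G \<in> P_s \<Omega> \<sigma> c" for F G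
    unfolding W_sigma_class_def W_sigma_eq_0_iff[OF some(2)[OF that(1)] some(2)[OF that(2)]]
    using quotient_eq_iff[OF equiv_ae_rel _ _ some(1)[OF that(1)] some(1)[OF that(2)]] that
    by (simp add: P_s_def)
  show "W_sigma_class \<Omega> \<sigma> c F H \<le> W_sigma_class \<Omega> \<sigma> c F G + W_sigma_class \<Omega> \<sigma> c G H"
    if "F \<in> P_s \<Omega> \<sigma> c" "G \<in> P_s \<Omega> \<sigma> c" "H \<in> P_s \<Omega> \<sigma> c" for F G H
    unfolding W_sigma_class_def W_sigma_def
    by (intro W2_triangle prob_space_P_sigma_measure W2_sq_P_sigma_measure_finite some(2) that)
qed

end

text \<open>The first two conjuncts give the metric its intended meaning: the choice of
  representatives is immaterial, and no value 0 arises from an infinite cost.\<close>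

theorem theorem4p2:
  fixes \<Omega> :: "'a::euclidean_space set" and \<sigma> :: "real \<Rightarrow> real" and c :: real
  assumes "\<Omega> \<noteq> {}" and "open \<Omega>" and "connected \<Omega>" and "bounded \<Omega>"
    and "\<And>x. \<sigma> x > 0" and "inj \<sigma>" and "C_infinity \<sigma>"
    and "c \<ge> 0"
  shows "W_sigma \<Omega> \<sigma> c respects2 ae_rel \<Omega> \<sigma> c
    \<and> (\<forall>f\<in>signed_densities \<Omega> \<sigma> c. \<forall>g\<in>signed_densities \<Omega> \<sigma> c.
         W2_sq (P_sigma_measure \<Omega> \<sigma> c f) (P_sigma_measure \<Omega> \<sigma> c g) < \<infinity>)
    \<and> Metric_space (P_s \<Omega> \<sigma> c) (W_sigma_class \<Omega> \<sigma> c)"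
proof -
  interpret sigma_normalization \<Omega> \<sigma> c
    using assms by unfold_locales auto
  show ?thesis
    by (intro conjI ballI W_sigma_respects2 W2_sq_P_sigma_measure_finite Metric_space_W_sigma_class)
qed

end
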